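(* In the setting of the context, let $(x_k)_{k\ge0}$ be the Bregman gradient descent iterates started at $x_0$: $$x_{k+1}=\nabla d^*\left(\nabla d(x_k)-\frac1L\nabla\phi(x_k)\right),\qquad k\ge0.$$ Let $\kappa=\mu/L$ and, for $k\ge1$, $$\eta_k^{-1}=L\min\left\{\frac1k,\ \frac{\kappa}{(1+\kappa)^k-1}\right\},$$ where the second term is omitted when $\mu=0$; let $\eta_0=0$. Then these iterates satisfy the implicit envelope descent scheme with this schedule, i.e. for every $k\ge0$, $\eta_{k+1}\ge\eta_k$ and $\phi(x_{k+1})\le\phi_\star^{\eta_{k+1}}$.
   Context: Setting. $d:\mathbb R^n\to\mathbb R\cup\{+\infty\}$ is a Legendre function: proper, closed, convex, differentiable on $\operatorname{int}(\operatorname{dom} d)$ with $\|\nabla d(u_j)\|\to\infty$ whenever $u_j$ tends to a boundary point of $\operatorname{dom} d$, and strictly convex on every convex subset of $\operatorname{dom}\partial d$; $d^*$ is its Fenchel conjugate, and $\nabla d:\operatorname{int}(\operatorname{dom} d)\to\operatorname{int}(\operatorname{dom} d^* )$ is a bijection with inverse $\nabla d^*$. $D_d(x,y)=d(x)-d(y)-\langle\nabla d(y),x-y\rangle$. $\mathcal X=\operatorname{cl}(\operatorname{dom} d)$, $x_0\in\operatorname{int}(\operatorname{dom} d)$. $f:\mathcal X\to\mathbb R$ is convex, differentiable, and relatively $(L-\mu)$-smooth with respect to $d$, i.e. $f(x)-f(y)-\langle\nabla f(y),x-y\rangle\le(L-\mu)D_d(x,y)$ for $x,y\in\operatorname{int}(\mathcal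 X)$, with $0\le\mu<L$. The objective is $\phi(x)=f(x)+\mu D_d(x,x_0)$. Standing convention: the minimizers of $\phi$ and of the subproblems exist and are interior; in particular the iterates above are well defined in $\operatorname{int}(\operatorname{dom} d)$. For $\eta>0$: $\phi^\eta(x)=\phi(x)+\frac1\eta D_d(x,x_0)$ and $\phi_\star^\eta=\min_x\phi^\eta(x)$. The implicit envelope descent scheme: starting from $\eta_0=0$, for each $k\ge0$ choose $\eta_{k+1}\ge\eta_k$ and find $x_{k+1}$ with $\phi(x_{k+1})\le\phi_\star^{\eta_{k+1}}$. *)

theory Defs
  imports "HOL-Analysis.Analysis"
begin

definition edom :: "('a \<Rightarrow> ereal) \<Rightarrow> 'a set" where
  "edom d = {x. d x < \<infinity>}"

definition ext_epigraph :: "('a \<Rightarrow> ereal) \<Rightarrow> ('a \<times> real) set" where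
  "ext_epigraph d = {(x, t). d x \<le> ereal t}"

definition proper :: "('a \<Rightarrow> ereal) \<Rightarrow> bool" where
  "proper d \<longleftrightarrow> (\<forall>x. d x \<noteq> -\<infinity>) \<and> (\<exists>x. d x \<noteq> \<infinity>)"

definition has_gradient_at :: "('a::real_inner \<Rightarrow> real) \<Rightarrow> 'a \<Rightarrow> bool" where
  "has_gradient_at g x \<longleftrightarrow> (\<exists>v. GDERIV g x :> v)"

definition gradient :: "('a::real_inner \<Rightarrow> real) \<Rightarrow> 'a \<Rightarrow> 'a" where
  "gradient g x = (THE v. GDERIV g x :> v)"

(* Gradients of extended-valued functions are only ever taken at interior points
   of the effective domain, near which real_of_ereal loses no information. *)
definition ext_gradient :: "('a::real_inner \<Rightarrow> ereal) \<Rightarrow> 'a \<Rightarrow> 'a" where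
  "ext_gradient d = gradient (\<lambda>x. real_of_ereal (d x))"

definition subdifferential :: "('a::real_inner \<Rightarrow> ereal) \<Rightarrow> 'a \<Rightarrow> 'a set" where
  "subdifferential d x = {v. \<forall>z. d x + ereal (v \<bullet> (z - x)) \<le> d z}"

definition strictly_convex_on :: "'a::real_vector set \<Rightarrow> ('a \<Rightarrow> ereal) \<Rightarrow> bool" where
  "strictly_convex_on C d \<longleftrightarrow>
     (\<forall>x\<in>C. \<forall>y\<in>C. \<forall>t. x \<noteq> y \<and> 0 < t \<and> t < 1 \<longrightarrow>
        d ((1 - t) *\<^sub>R x + t *\<^sub>R y) < ereal (1 - t) * d x + ereal t * d y)"

definition legendre :: "('a::euclidean_space \<Rightarrow> ereal) \<Rightarrow> bool" where
  "legendre d \<longleftrightarrow>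
     proper d \<and> closed (ext_epigraph d) \<and> convex (ext_epigraph d) \<and>
     (\<forall>x\<in>interior (edom d). has_gradient_at (\<lambda>z. real_of_ereal (d z)) x) \<and>
     (\<forall>u b. (\<forall>j. u j \<in> interior (edom d)) \<and> b \<in> frontier (edom d) \<and> u \<longlonglongrightarrow> b \<longrightarrow>
        filterlim (\<lambda>j. norm (ext_gradient d (u j))) at_top sequentially) \<and>
     (\<forall>C. convex C \<and> C \<subseteq> {x. subdifferential d x \<noteq> {}} \<longrightarrow> strictly_convex_on C d)"

definition fenchel_conjugate :: "('a::real_inner \<Rightarrow> ereal) \<Rightarrow> 'a \<Rightarrow> ereal" where
  "fenchel_conjugate d y = (SUP x. ereal (y \<bullet> x) - d x)"

(* The second argument is meant to lie in the interior of the effective domain;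
   the value is infinite when the first one lies outside the effective domain. *)
definition bregman :: "('a::real_inner \<Rightarrow> ereal) \<Rightarrow> 'a \<Rightarrow> 'a \<Rightarrow> ereal" where
  "bregman d x y = d x - d y - ereal (ext_gradient d y \<bullet> (x - y))"

definition relatively_smooth ::
    "real \<Rightarrow> ('a::euclidean_space \<Rightarrow> ereal) \<Rightarrow> ('a \<Rightarrow> real) \<Rightarrow> bool" where
  "relatively_smooth M d f \<longleftrightarrow>
     (\<forall>x\<in>interior (closure (edom d)). \<forall>y\<in>interior (closure (edom d)).
        ereal (f x - f y - gradient f y \<bullet> (x - y)) \<le> ereal M * bregman d x y)"

(* f is only meaningful on the closed set closure (edom d), and the minimizations
   below range over that set. For \<mu> = 0 the Bregman term vanishes also where it is
   infinite, since 0 * \<infinity> = 0 in ereal. *)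
definition objective ::
    "('a::euclidean_space \<Rightarrow> ereal) \<Rightarrow> ('a \<Rightarrow> real) \<Rightarrow> real \<Rightarrow> 'a \<Rightarrow> 'a \<Rightarrow> ereal" where
  "objective d f \<mu> x0 x = ereal (f x) + ereal \<mu> * bregman d x x0"

definition envelope_objective ::
    "('a::euclidean_space \<Rightarrow> ereal) \<Rightarrow> ('a \<Rightarrow> real) \<Rightarrow> real \<Rightarrow> 'a \<Rightarrow> real \<Rightarrow> 'a \<Rightarrow> ereal" where
  "envelope_objective d f \<mu> x0 \<eta> x = objective d f \<mu> x0 x + ereal (1 / \<eta>) * bregman d x x0"

definition envelope_min ::
    "('a::euclidean_space \<Rightarrow> ereal) \<Rightarrow> ('a \<Rightarrow> real) \<Rightarrow> real \<Rightarrow> 'a \<Rightarrow> real \<Rightarrow> ereal" where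
  "envelope_min d f \<mu> x0 \<eta> = (INF x\<in>closure (edom d). envelope_objective d f \<mu> x0 \<eta> x)"

(* Positivity of the parameters is part of the scheme because the regularized
   objective is defined for \<eta> > 0 only (in HOL, 1 / 0 = 0). *)
definition implicit_envelope_descent ::
    "('a::euclidean_space \<Rightarrow> ereal) \<Rightarrow> ('a \<Rightarrow> real) \<Rightarrow> real \<Rightarrow> 'a \<Rightarrow>
     (nat \<Rightarrow> real) \<Rightarrow> (nat \<Rightarrow> 'a) \<Rightarrow> bool" where
  "implicit_envelope_descent d f \<mu> x0 \<eta> x \<longleftrightarrow>
     \<eta> 0 = 0 \<and>
     (\<forall>k. 0 < \<eta> (Suc k) \<and> \<eta> k \<le> \<eta> (Suc k) \<and>
          objective d f \<mu> x0 (x (Suc k)) \<le> envelope_min d f \<mu> x0 (\<eta> (Suc k)))"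

definition bregman_gd_dual_point ::
    "('a::euclidean_space \<Rightarrow> ereal) \<Rightarrow> ('a \<Rightarrow> real) \<Rightarrow> real \<Rightarrow> real \<Rightarrow> 'a \<Rightarrow> 'a \<Rightarrow> 'a" where
  "bregman_gd_dual_point d f L \<mu> x0 z =
     ext_gradient d z - (1 / L) *\<^sub>R ext_gradient (objective d f \<mu> x0) z"

definition bregman_gd_step ::
    "('a::euclidean_space \<Rightarrow> ereal) \<Rightarrow> ('a \<Rightarrow> real) \<Rightarrow> real \<Rightarrow> real \<Rightarrow> 'a \<Rightarrow> 'a \<Rightarrow> 'a" where
  "bregman_gd_step d f L \<mu> x0 z =
     ext_gradient (fenchel_conjugate d) (bregman_gd_dual_point d f L \<mu> x0 z)"

definition eta_schedule :: "real \<Rightarrow> real \<Rightarrow> nat \<Rightarrow> real" where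
  "eta_schedule L \<mu> k =
     (if k = 0 then 0
      else inverse (L * (if \<mu> = 0 then 1 / real k
                         else min (1 / real k) ((\<mu> / L) / ((1 + \<mu> / L) ^ k - 1)))))"

end

theory Submission
  imports Defs
begin

text \<open>
  With \<open>D\<close> the Bregman distance of \<open>d\<close>, convexity and relative smoothness of \<open>f\<close>, combined with
  the three-point identity for \<open>D\<close>, give for every \<open>y\<close> in the domain of \<open>d\<close>
  \[ \phi(x_{k+1}) - \phi(y) \le (L-\mu) D(y,x_k) - L D(y,x_{k+1}). \]
  The choice \<open>y = x\<^sub>k\<close> shows that \<open>\<phi>(x\<^sub>k)\<close> decreases. Weighting the inequalities by the powers of
  \<open>1 + \<kappa>\<close> and summing makes the distances telescope, because \<open>(1 + \<kappa>) (L - \<mu>) \<le> L\<close>, and leaves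
  \<open>(\<Sum>j<k. (1 + \<kappa>) ^ j) (\<phi>(x\<^sub>k) - \<phi>(y)) \<le> L D(y, x\<^sub>0)\<close>. By Bernoulli's inequality
  that sum of powers is exactly \<open>L \<eta>\<^sub>k\<close>.

  The three-point identity needs \<open>\<nabla>d(\<nabla>d\<^sup>*(p)) = p\<close> for \<open>p\<close> interior to the domain of \<open>d\<^sup>*\<close>:
  there \<open>d - \<langle>p, \<cdot>\<rangle>\<close> is coercive, strict convexity makes its minimizer \<open>z\<close> unique, and it grows
  linearly away from \<open>z\<close>, which forces \<open>d\<^sup>*\<close> to be differentiable at \<open>p\<close> with gradient \<open>z\<close>.
\<close>

section \<open>Gradients of convex functions\<close>

lemma gradient_eqI:
  assumes "GDERIV g x :> v"
  shows "gradient g x = v"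
proof -
  have "w = v" if "GDERIV g x :> w" for w
  proof -
    have "(\<lambda>h. h \<bullet> w) = (\<lambda>h. h \<bullet> v)"
      using has_derivative_unique that assms unfolding gderiv_def by blast
    then show ?thesis
      by (metis inner_commute vector_eq_rdot)
  qed
  then show ?thesis
    unfolding gradient_def using assms by blast
qed

lemma GDERIV_gradient: "has_gradient_at g x \<Longrightarrow> GDERIV g x :> gradient g x"
  unfolding has_gradient_at_def using gradient_eqI by metis

text \<open>Chain rule along a ray. Only positive \<open>t\<close> is kept, because both convexity
  arguments below bound the difference quotient for small positive \<open>t\<close>.\<close>

lemma GDERIV_directional_limit:
  fixes g :: "'a::real_inner \<Rightarrow> real"
  assumes "GDERIV g y :> v"
  shows "((\<lambda>t. (g (y + t *\<^sub>R w) - g y) / t) \<longlongrightarrow> v \<bullet> w) (at_right 0)"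
proof -
  have 1: "((\<lambda>t. y + t *\<^sub>R w) has_derivative (\<lambda>t. t *\<^sub>R w)) (at (0::real))"
    by (auto intro!: derivative_eq_intros)
  have "((g \<circ> (\<lambda>t. y + t *\<^sub>R w)) has_derivative ((\<lambda>h. h \<bullet> v) \<circ> (\<lambda>t. t *\<^sub>R w))) (at 0)"
    by (rule diff_chain_at[OF 1]) (use assms in \<open>simp add: gderiv_def\<close>)
  then have "((\<lambda>t. g (y + t *\<^sub>R w)) has_field_derivative (v \<bullet> w)) (at 0)"
    by (simp add: has_field_derivative_def o_def inner_commute mult_commute_abs)
  then have "((\<lambda>t. (g (y + t *\<^sub>R w) - g y) / t) \<longlongrightarrow> v \<bullet> w) (at 0)"
    by (simp add: has_field_derivative_iff)
  then show ?thesis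
    by (simp add: filterlim_at_split)
qed

text \<open>Convexity bounds every difference quotient on the segment from \<open>y\<close> to
  \<open>x\<close> by \<open>g x - g y\<close>; letting \<open>t\<close> tend to 0 turns the
  quotient into \<open>v \<bullet> (x - y)\<close>.\<close>

lemma convex_on_above_gradient:
  fixes g :: "'a::real_inner \<Rightarrow> real"
  assumes "convex_on S g" and "y \<in> S" and "x \<in> S" and "GDERIV g y :> v"
  shows "g y + v \<bullet> (x - y) \<le> g x"
proof -
  have "\<forall>\<^sub>F t in at_right 0. (g (y + t *\<^sub>R (x - y)) - g y) / t \<le> g x - g y"
    unfolding eventually_at_right_field
  proof (intro exI conjI allI impI)
    fix t :: real assume t: "0 < t" "t < 1"
    have "g ((1 - t) *\<^sub>R y + t *\<^sub>R x) \<le> (1 - t) * g y + t * g x"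
      using assms t by (intro convex_onD[OF assms(1)]) auto
    moreover have "(1 - t) *\<^sub>R y + t *\<^sub>R x = y + t *\<^sub>R (x - y)"
      by (simp add: algebra_simps)
    ultimately show "(g (y + t *\<^sub>R (x - y)) - g y) / t \<le> g x - g y"
      using t by (simp add: field_simps)
  qed simp
  then have "v \<bullet> (x - y) \<le> g x - g y"
    by (rule tendsto_upperbound[OF GDERIV_directional_limit[OF assms(4)]]) simp
  then show ?thesis by simp
qed

text \<open>Testing the subgradient inequality in the direction \<open>w = p - v\<close> gives
  \<open>p \<bullet> w \<le> v \<bullet> w\<close> in the limit, so the squared norm of
  \<open>w\<close> is at most 0.\<close>

lemma subgradient_eq_gradient:
  fixes g :: "'a::real_inner \<Rightarrow> real"
  assumes "y \<in> interior S" and "GDERIV g y :> v"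
    and sub: "\<And>x. x \<in> S \<Longrightarrow> g y + p \<bullet> (x - y) \<le> g x"
  shows "p = v"
proof -
  obtain e where e: "e > 0" "ball y e \<subseteq> S"
    using assms(1) mem_interior by blast
  define w where "w = p - v"
  have "\<forall>\<^sub>F t in at_right 0. p \<bullet> w \<le> (g (y + t *\<^sub>R w) - g y) / t"
    unfolding eventually_at_right_field
  proof (intro exI conjI allI impI)
    \<comment> \<open>Adding 1 keeps the radius meaningful when \<open>w = 0\<close>;
      \<open>t\<close> below it leaves \<open>y + t *\<^sub>R w\<close> inside the ball.\<close>
    show "0 < e / (norm w + 1)"
      using e by (simp add: add_nonneg_pos)
    fix t :: real assume t: "0 < t" "t < e / (norm w + 1)"
    have "t * norm w \<le> t * (norm w + 1)" using t by simp
    also have "\<dots> < e" using t(2) by (simp add: pos_less_divide_eq add_nonneg_pos)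
    finally have "y + t *\<^sub>R w \<in> S"
      using e t by (auto intro!: subsetD[OF e(2)] simp: dist_norm)
    from sub[OF this] show "p \<bullet> w \<le> (g (y + t *\<^sub>R w) - g y) / t"
      using t by (simp add: field_simps)
  qed
  then have "p \<bullet> w \<le> v \<bullet> w"
    by (rule tendsto_lowerbound[OF GDERIV_directional_limit[OF assms(2)]]) simp
  then have "w \<bullet> w \<le> 0" by (simp add: w_def inner_diff_left)
  then have "w = 0" using inner_ge_zero[of w] inner_eq_zero_iff[of w] by linarith
  then show ?thesis by (simp add: w_def)
qed

section \<open>Extended-valued convex functions\<close>

lemma proper_eq_ereal:
  assumes "proper d" and "x \<in> edom d"
  shows "d x = ereal (real_of_ereal (d x))"
  using assms by (cases "d x") (auto simp: proper_def edom_def)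

lemma ext_epigraph_iff:
  assumes "proper d"
  shows "(x, t) \<in> ext_epigraph d \<longleftrightarrow> x \<in> edom d \<and> real_of_ereal (d x) \<le> t"
  using assms by (cases "d x") (auto simp: proper_def edom_def ext_epigraph_def)

lemma convex_on_edom:
  fixes d :: "'a::real_vector \<Rightarrow> ereal"
  assumes "proper d" and "convex (ext_epigraph d)"
  shows "convex_on (edom d) (\<lambda>x. real_of_ereal (d x))"
proof -
  have *: "(1 - t) *\<^sub>R x + t *\<^sub>R y \<in> edom d \<and>
        real_of_ereal (d ((1 - t) *\<^sub>R x + t *\<^sub>R y))
          \<le> (1 - t) * real_of_ereal (d x) + t * real_of_ereal (d y)"
    if "x \<in> edom d" "y \<in> edom d" "0 \<le> t" "t \<le> 1" for x y t
  proof -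
    have "(1 - t) *\<^sub>R (x, real_of_ereal (d x)) + t *\<^sub>R (y, real_of_ereal (d y)) \<in> ext_epigraph d"
      using that by (intro convexD[OF assms(2)]) (auto simp: ext_epigraph_iff[OF assms(1)])
    then show ?thesis by (simp add: ext_epigraph_iff[OF assms(1)])
  qed
  show ?thesis
    by (rule convex_onI) (use * in \<open>auto simp: convex_alt\<close>)
qed

text \<open>Where \<open>d\<close> is infinite the defining inequality fails at some point of the
  domain, which properness supplies; elsewhere everything reduces to real numbers.\<close>

lemma subdifferential_iff:
  assumes "proper d"
  shows "p \<in> subdifferential d x \<longleftrightarrow> x \<in> edom d \<and>
    (\<forall>y\<in>edom d. real_of_ereal (d x) + p \<bullet> (y - x) \<le> real_of_ereal (d y))"
proof -
  obtain u where u: "u \<in> edom d"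
    using assms by (auto simp: proper_def edom_def)
  have "x \<in> edom d" if "p \<in> subdifferential d x"
  proof (rule ccontr)
    assume "x \<notin> edom d"
    then have "d x = \<infinity>" by (simp add: edom_def)
    moreover have "d x + ereal (p \<bullet> (u - x)) \<le> d u"
      using that unfolding subdifferential_def by blast
    ultimately have "d u = \<infinity>" by simp
    with u show False by (simp add: edom_def)
  qed
  moreover have "d x + ereal (p \<bullet> (y - x)) \<le> d y \<longleftrightarrow>
      (y \<in> edom d \<longrightarrow> real_of_ereal (d x) + p \<bullet> (y - x) \<le> real_of_ereal (d y))"
    if "x \<in> edom d" for y
    using assms that by (cases "d x"; cases "d y") (auto simp: edom_def proper_def)
  ultimately show ?thesis
    unfolding subdifferential_def by auto
qed

section \<open>The gradient of the conjugate\<close>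

text \<open>Around an interior \<open>p\<close> the conjugate is finite at \<open>p + u\<close> for
  small \<open>u\<close>. The Fenchel-Young inequality then bounds \<open>u \<bullet> x\<close> by a
  constant plus \<open>d x - p \<bullet> x\<close>, and letting \<open>u\<close> run through
  multiples of the basis vectors bounds the 1-norm of \<open>x\<close>.\<close>

lemma conjugate_interior_coercive:
  fixes d :: "'a::euclidean_space \<Rightarrow> ereal"
  assumes "proper d" and "p \<in> interior (edom (fenchel_conjugate d))"
  obtains K M where "K > 0"
    and "\<And>x. x \<in> edom d \<Longrightarrow> norm x \<le> K * (M + real_of_ereal (d x) - p \<bullet> x)"
proof -
  obtain e where e: "e > 0" "cball p e \<subseteq> edom (fenchel_conjugate d)"
    using assms(2) mem_interior_cball by blast
  \<comment> \<open>The vertices of a cross-polytope: finitely many perturbations suffice, so their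
    conjugate values have a maximum \<open>M\<close>.\<close>
  define U where "U = (\<lambda>b. e *\<^sub>R b) ` (Basis :: 'a set) \<union> (\<lambda>b. - e *\<^sub>R b) ` (Basis :: 'a set)"
  define m where "m u = real_of_ereal (fenchel_conjugate d (p + u))" for u
  define M where "M = Max (m ` U)"
  have U: "finite U" by (simp add: U_def)
  have bound: "p \<bullet> x + u \<bullet> x - real_of_ereal (d x) \<le> M" if "u \<in> U" "x \<in> edom d" for u x
  proof -
    have "norm u \<le> e"
      using that(1) e(1) by (auto simp: U_def)
    then have "p + u \<in> edom (fenchel_conjugate d)"
      using e by (auto intro!: subsetD[OF e(2)] simp: dist_norm)
    then have fin: "fenchel_conjugate d (p + u) < \<infinity>" by (simp add: edom_def)
    have "ereal ((p + u) \<bullet> x) - d x \<le> fenchel_conjugate d (p + u)"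
      unfolding fenchel_conjugate_def by (rule SUP_upper) simp
    then have "ereal ((p + u) \<bullet> x - real_of_ereal (d x)) \<le> fenchel_conjugate d (p + u)"
      by (subst (asm) proper_eq_ereal[OF assms(1) that(2)]) simp
    then have "(p + u) \<bullet> x - real_of_ereal (d x) \<le> m u"
      using fin unfolding m_def by (cases "fenchel_conjugate d (p + u)") auto
    also have "m u \<le> M" unfolding M_def using U that(1) by simp
    finally show ?thesis by (simp add: inner_add_left)
  qed
  have "norm x \<le> (DIM('a) / e) * (M + real_of_ereal (d x) - p \<bullet> x)" if x: "x \<in> edom d" for x
  proof -
    have "\<bar>x \<bullet> b\<bar> \<le> (M + real_of_ereal (d x) - p \<bullet> x) / e" if b: "b \<in> Basis" for b
    proof -
      have "e *\<^sub>R b \<in> U" "- e *\<^sub>R b \<in> U" using b by (auto simp: U_def)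
      from bound[OF this(1) x] bound[OF this(2) x]
      have "e * \<bar>x \<bullet> b\<bar> \<le> M + real_of_ereal (d x) - p \<bullet> x"
        by (auto simp: inner_commute abs_if)
      then show ?thesis using e(1) by (simp add: field_simps)
    qed
    then have "(\<Sum>b\<in>Basis. \<bar>x \<bullet> b\<bar>) \<le> DIM('a) * ((M + real_of_ereal (d x) - p \<bullet> x) / e)"
      by (rule sum_bounded_above)
    with norm_le_l1[of x] show ?thesis by simp
  qed
  moreover have "DIM('a) / e > 0" using e(1) by simp
  ultimately show ?thesis using that by blast
qed

text \<open>The direct method carried out on the epigraph: its closedness stands in for lower
  semicontinuity of \<open>d\<close>, and the function to minimize,
  \<open>t - p \<bullet> x\<close>, is continuous in \<open>(x, t)\<close>.\<close>

lemma coercive_attains_min: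
  fixes d :: "'a::euclidean_space \<Rightarrow> ereal"
  assumes "proper d" and "closed (ext_epigraph d)" and "K > 0"
    and coercive: "\<And>x. x \<in> edom d \<Longrightarrow> norm x \<le> K * (M + real_of_ereal (d x) - p \<bullet> x)"
    and "closed C" and "x1 \<in> C \<inter> edom d"
  obtains z where "z \<in> C \<inter> edom d"
    and "\<And>x. x \<in> C \<inter> edom d \<Longrightarrow> real_of_ereal (d z) - p \<bullet> z \<le> real_of_ereal (d x) - p \<bullet> x"
proof -
  define \<alpha> where "\<alpha> = real_of_ereal (d x1) - p \<bullet> x1"
  define g where "g = (\<lambda>w :: 'a \<times> real. snd w - p \<bullet> fst w)"
  define S where "S = ext_epigraph d \<inter> (C \<times> UNIV) \<inter> {w. g w \<le> \<alpha>}"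
  have g: "continuous_on A g" for A
    unfolding g_def by (intro continuous_intros)
  have "closed {w. g w \<le> \<alpha>}"
    by (intro closed_Collect_le g continuous_on_const)
  then have "closed S"
    unfolding S_def using assms(2,5) by (intro closed_Int closed_Times) auto
  moreover have "bounded S"
  proof -
    \<comment> \<open>Coercivity bounds \<open>x\<close>. The upper bound on \<open>t\<close> comes
      from the sublevel condition, the lower one from the right-hand side of the coercivity estimate
      being nonnegative.\<close>
    have "S \<subseteq> cball 0 (K * (M + \<alpha>)) \<times> {- M - norm p * (K * (M + \<alpha>)) .. \<alpha> + norm p * (K * (M + \<alpha>))}"
    proof (clarify, intro conjI)
      fix x t assume "(x, t) \<in> S"
      then have x: "x \<in> edom d" and dt: "real_of_ereal (d x) \<le> t" and t: "t - p \<bullet> x \<le> \<alpha>"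
        by (auto simp: S_def g_def ext_epigraph_iff[OF assms(1)])
      have "norm x \<le> K * (M + real_of_ereal (d x) - p \<bullet> x)" by (rule coercive[OF x])
      also have "\<dots> \<le> K * (M + \<alpha>)" using \<open>K > 0\<close> dt t by simp
      finally have nx: "norm x \<le> K * (M + \<alpha>)" .
      then show "x \<in> cball 0 (K * (M + \<alpha>))" by simp
      have "0 \<le> K * (M + real_of_ereal (d x) - p \<bullet> x)"
        using coercive[OF x] norm_ge_zero order_trans by blast
      then have "0 \<le> M + real_of_ereal (d x) - p \<bullet> x"
        using \<open>K > 0\<close> by (simp add: zero_le_mult_iff)
      moreover have "\<bar>p \<bullet> x\<bar> \<le> norm p * (K * (M + \<alpha>))"
        using Cauchy_Schwarz_ineq2[of p x] mult_left_mono[OF nx, of "norm p"] by simp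
      ultimately show "t \<in> {- M - norm p * (K * (M + \<alpha>)) .. \<alpha> + norm p * (K * (M + \<alpha>))}"
        using dt t by auto
    qed
    then show ?thesis
      by (rule bounded_subset[rotated]) (intro bounded_Times bounded_cball bounded_closed_interval)
  qed
  ultimately have "compact S" by (simp add: compact_eq_bounded_closed)
  moreover have x1S: "(x1, real_of_ereal (d x1)) \<in> S"
    using assms(6) by (auto simp: S_def g_def \<alpha>_def ext_epigraph_iff[OF assms(1)])
  ultimately obtain w where w: "w \<in> S" "\<And>v. v \<in> S \<Longrightarrow> g w \<le> g v"
    using continuous_attains_inf[OF _ _ g, of S] by blast
  obtain z s where ws: "w = (z, s)" by (cases w)
  have z: "z \<in> C \<inter> edom d" "real_of_ereal (d z) \<le> s"
    using w(1) by (auto simp: ws S_def ext_epigraph_iff[OF assms(1)])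
  show ?thesis
  proof (rule that[OF z(1)])
    fix x assume x: "x \<in> C \<inter> edom d"
    have "real_of_ereal (d z) - p \<bullet> z \<le> g w" using z(2) by (simp add: g_def ws)
    also have "g w \<le> real_of_ereal (d x) - p \<bullet> x"
    proof (cases "real_of_ereal (d x) - p \<bullet> x \<le> \<alpha>")
      case True
      then have "(x, real_of_ereal (d x)) \<in> S"
        using x by (auto simp: S_def g_def ext_epigraph_iff[OF assms(1)])
      from w(2)[OF this] show ?thesis by (simp add: g_def)
    next
      case False
      with w(1) show ?thesis by (simp add: S_def)
    qed
    finally show "real_of_ereal (d z) - p \<bullet> z \<le> real_of_ereal (d x) - p \<bullet> x" .
  qed
qed

text \<open>The points with subgradient \<open>p\<close> are the minimizers of \<open>d\<close>
  minus the linear form of \<open>p\<close>. They form a convex set, so \<open>d\<close> is strictly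
  convex on it, which leaves room for only one point.\<close>

lemma legendre_subgradient_point_unique:
  fixes d :: "'a::euclidean_space \<Rightarrow> ereal"
  assumes "legendre d" and "p \<in> subdifferential d y" and "p \<in> subdifferential d z"
  shows "y = z"
proof (rule ccontr)
  assume "y \<noteq> z"
  have pr: "proper d" and cvx: "convex (ext_epigraph d)"
    and strict: "\<And>C. convex C \<Longrightarrow> C \<subseteq> {x. subdifferential d x \<noteq> {}} \<Longrightarrow> strictly_convex_on C d"
    using assms(1) by (auto simp: legendre_def)
  note iff = subdifferential_iff[OF pr]
  define r where "r x = real_of_ereal (d x)" for x
  have convex_r: "convex_on (edom d) r"
    unfolding r_def by (rule convex_on_edom[OF pr cvx])
  \<comment> \<open>Strict convexity is available only on convex sets of points that have
    subgradients; \<open>C\<close> is such a set once it is shown convex.\<close>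
  define C where "C = {x. p \<in> subdifferential d x}"
  have "convex C"
    unfolding convex_alt
  proof (intro ballI allI impI)
    fix a b t assume ab: "a \<in> C" "b \<in> C" and t: "0 \<le> t \<and> t \<le> (1::real)"
    define c where "c = (1 - t) *\<^sub>R a + t *\<^sub>R b"
    have a: "a \<in> edom d" "\<And>w. w \<in> edom d \<Longrightarrow> r a + p \<bullet> (w - a) \<le> r w"
      and b: "b \<in> edom d" "\<And>w. w \<in> edom d \<Longrightarrow> r b + p \<bullet> (w - b) \<le> r w"
      using ab by (auto simp: C_def iff r_def)
    have c: "c \<in> edom d"
      unfolding c_def using a(1) b(1) t convex_on_imp_convex[OF convex_r]
      by (auto simp: convex_alt)
    have rc: "r c \<le> (1 - t) * r a + t * r b"
      unfolding c_def using convex_onD[OF convex_r _ _ a(1) b(1)] t by simp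
    have "r c + p \<bullet> (w - c) \<le> r w" if w: "w \<in> edom d" for w
    proof -
      have "(1 - t) * (r a + p \<bullet> (w - a)) + t * (r b + p \<bullet> (w - b)) \<le> (1 - t) * r w + t * r w"
        using t by (intro add_mono mult_left_mono a(2) b(2) w) auto
      moreover have "p \<bullet> (w - c) = (1 - t) * (p \<bullet> (w - a)) + t * (p \<bullet> (w - b))"
        by (simp add: c_def inner_simps algebra_simps)
      ultimately show ?thesis using rc by (simp add: algebra_simps)
    qed
    then show "(1 - t) *\<^sub>R a + t *\<^sub>R b \<in> C"
      using c unfolding C_def c_def[symmetric] by (auto simp: iff r_def)
  qed
  then have "strictly_convex_on C d"
    by (rule strict) (auto simp: C_def)
  then have lt: "d ((1 - 1/2) *\<^sub>R y + (1/2) *\<^sub>R z) < ereal (1 - 1/2) * d y + ereal (1/2) * d z"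
    unfolding strictly_convex_on_def
    using assms(2,3) \<open>y \<noteq> z\<close> by (elim ballE[of _ _ y] ballE[of _ _ z] allE[of _ "1/2"]) (simp_all add: C_def)
  define m where "m = (1 - 1/2) *\<^sub>R y + (1/2) *\<^sub>R z"
  have y: "y \<in> edom d" "\<And>w. w \<in> edom d \<Longrightarrow> r y + p \<bullet> (w - y) \<le> r w"
    and z: "z \<in> edom d" "\<And>w. w \<in> edom d \<Longrightarrow> r z + p \<bullet> (w - z) \<le> r w"
    using assms(2,3) by (auto simp: iff r_def)
  have m: "m \<in> edom d"
    unfolding m_def using y(1) z(1) by (intro convexD[OF convex_on_imp_convex[OF convex_r]]) auto
  have "ereal (r m) < ereal (1/2 * r y + 1/2 * r z)"
    using lt unfolding m_def[symmetric] r_def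
    using proper_eq_ereal[OF pr y(1)] proper_eq_ereal[OF pr z(1)] proper_eq_ereal[OF pr m]
    by (cases "d y"; cases "d z"; cases "d m") simp_all
  then have "r m < 1/2 * r y + 1/2 * r z" by simp
  \<comment> \<open>At the midpoint the linear terms of the two subgradient inequalities cancel, so
    their sum contradicts the strict inequality.\<close>
  moreover have "p \<bullet> (m - y) + p \<bullet> (m - z) = 0"
    by (simp add: m_def inner_simps)
  ultimately show False using y(2)[OF m] z(2)[OF m] by simp
qed

text \<open>Convexity transfers growth from the sphere of radius \<open>\<epsilon>\<close> to
  everything outside it, and on the sphere the gap to the minimum is attained, hence
  positive.\<close>

lemma unique_min_linear_growth:
  fixes d :: "'a::euclidean_space \<Rightarrow> ereal"
  assumes "proper d" and "closed (ext_epigraph d)" and "convex (ext_epigraph d)" and "K > 0"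
    and coercive: "\<And>x. x \<in> edom d \<Longrightarrow> norm x \<le> K * (M + real_of_ereal (d x) - p \<bullet> x)"
    and "z \<in> edom d"
    and strict: "\<And>x. x \<in> edom d \<Longrightarrow> x \<noteq> z \<Longrightarrow>
      real_of_ereal (d z) - p \<bullet> z < real_of_ereal (d x) - p \<bullet> x"
    and "\<epsilon> > 0"
  obtains c where "c > 0"
    and "\<And>x. x \<in> edom d \<Longrightarrow> norm (x - z) \<ge> \<epsilon> \<Longrightarrow>
      c * norm (x - z) \<le> (real_of_ereal (d x) - p \<bullet> x) - (real_of_ereal (d z) - p \<bullet> z)"
proof -
  define g where "g x = real_of_ereal (d x) - p \<bullet> x" for x
  note convex_d = convex_on_edom[OF assms(1,3)]
  have to_sphere: "\<exists>y\<in>sphere z \<epsilon> \<inter> edom d. norm (x - z) * (g y - g z) \<le> \<epsilon> * (g x - g z)"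
    if x: "x \<in> edom d" "norm (x - z) \<ge> \<epsilon>" for x
  proof -
    \<comment> \<open>The parameter at which the segment from \<open>z\<close> to \<open>x\<close>
      crosses the sphere.\<close>
    define s where "s = \<epsilon> / norm (x - z)"
    have n: "norm (x - z) > 0" using x \<open>\<epsilon> > 0\<close> by linarith
    then have s: "0 < s" "s \<le> 1" using x \<open>\<epsilon> > 0\<close> by (auto simp: s_def)
    define y where "y = (1 - s) *\<^sub>R z + s *\<^sub>R x"
    have "z - y = s *\<^sub>R (z - x)" by (simp add: y_def algebra_simps)
    then have "y \<in> sphere z \<epsilon>"
      using n s using \<open>\<epsilon> > 0\<close> by (simp add: dist_norm s_def norm_minus_commute)
    moreover have "y \<in> edom d"
      unfolding y_def using convex_on_imp_convex[OF convex_d] x assms(6) s by (auto simp: convex_alt)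
    moreover have "real_of_ereal (d y) \<le> (1 - s) * real_of_ereal (d z) + s * real_of_ereal (d x)"
      unfolding y_def using convex_onD[OF convex_d, of s z x] x assms(6) s by auto
    then have "g y - g z \<le> s * (g x - g z)"
      by (simp add: g_def y_def inner_simps algebra_simps)
    then have "norm (x - z) * (g y - g z) \<le> \<epsilon> * (g x - g z)"
      using n by (simp add: s_def field_simps)
    ultimately show ?thesis by blast
  qed
  show ?thesis
  proof (cases "sphere z \<epsilon> \<inter> edom d = {}")
    \<comment> \<open>By \<open>to_sphere\<close> no point of the domain is then as far as
      \<open>\<epsilon>\<close> from \<open>z\<close>, so any \<open>c\<close> works
      vacuously.\<close>
    case True
    then show ?thesis using that[of 1] to_sphere by fastforce
  next
    case False
    then obtain x1 where "x1 \<in> sphere z \<epsilon> \<inter> edom d" by blast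
    then obtain w where w: "w \<in> sphere z \<epsilon> \<inter> edom d"
      and w_min: "\<And>x. x \<in> sphere z \<epsilon> \<inter> edom d \<Longrightarrow> g w \<le> g x"
      unfolding g_def using coercive_attains_min[OF assms(1,2,4) coercive closed_sphere] by metis
    have gw: "g z < g w"
      using strict[of w] w \<open>\<epsilon> > 0\<close> by (auto simp: g_def)
    show ?thesis
    proof (rule that[of "(g w - g z) / \<epsilon>"])
      show "0 < (g w - g z) / \<epsilon>" using gw \<open>\<epsilon> > 0\<close> by simp
      fix x assume "x \<in> edom d" "\<epsilon> \<le> norm (x - z)"
      then obtain y where y: "y \<in> sphere z \<epsilon> \<inter> edom d"
        and le: "norm (x - z) * (g y - g z) \<le> \<epsilon> * (g x - g z)"
        using to_sphere by blast
      have "norm (x - z) * (g w - g z) \<le> norm (x - z) * (g y - g z)"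
        using w_min[OF y] by (intro mult_left_mono) auto
      with le have "(g w - g z) / \<epsilon> * norm (x - z) \<le> g x - g z"
        using \<open>\<epsilon> > 0\<close> by (simp add: field_simps)
      then show "(g w - g z) / \<epsilon> * norm (x - z)
          \<le> (real_of_ereal (d x) - p \<bullet> x) - (real_of_ereal (d z) - p \<bullet> z)"
        by (simp add: g_def)
    qed
  qed
qed

text \<open>In the supremum defining the conjugate at \<open>q\<close> with
  \<open>norm (q - p) < c\<close>, a point at distance at least \<open>\<epsilon>\<close> from
  \<open>z\<close> loses more by growth than the change of slope gains, and a nearer one gains at
  most \<open>\<epsilon> * norm (q - p)\<close>. So \<open>z\<close> is nearly optimal, and the
  growth constant \<open>c\<close> serves as the radius.\<close>

lemma GDERIV_conjugate_of_linear_growth: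
  fixes d :: "'a::real_inner \<Rightarrow> ereal"
  assumes "proper d" and "z \<in> edom d"
    and min: "\<And>x. x \<in> edom d \<Longrightarrow> real_of_ereal (d z) - p \<bullet> z \<le> real_of_ereal (d x) - p \<bullet> x"
    and growth: "\<And>\<epsilon>. \<epsilon> > 0 \<Longrightarrow> \<exists>c>0. \<forall>x\<in>edom d. norm (x - z) \<ge> \<epsilon> \<longrightarrow>
      c * norm (x - z) \<le> (real_of_ereal (d x) - p \<bullet> x) - (real_of_ereal (d z) - p \<bullet> z)"
  shows "GDERIV (\<lambda>q. real_of_ereal (fenchel_conjugate d q)) p :> z"
proof -
  define r where "r x = real_of_ereal (d x)" for x
  have lower: "ereal (q \<bullet> z - r z) \<le> fenchel_conjugate d q" for q
  proof -
    have "ereal (q \<bullet> z) - d z \<le> fenchel_conjugate d q"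
      unfolding fenchel_conjugate_def by (rule SUP_upper) simp
    then show ?thesis
      unfolding r_def by (subst (asm) proper_eq_ereal[OF assms(1,2)]) simp
  qed
  have upper: "fenchel_conjugate d q \<le> ereal B" if "\<And>x. x \<in> edom d \<Longrightarrow> q \<bullet> x - r x \<le> B" for q B
    unfolding fenchel_conjugate_def
  proof (rule SUP_least)
    fix x
    show "ereal (q \<bullet> x) - d x \<le> ereal B"
    proof (cases "x \<in> edom d")
      case True
      show ?thesis
        by (subst proper_eq_ereal[OF assms(1) True]) (use that[OF True] in \<open>simp add: r_def\<close>)
    next
      case False
      then show ?thesis by (simp add: edom_def)
    qed
  qed
  have at_p: "real_of_ereal (fenchel_conjugate d p) = p \<bullet> z - r z"
  proof -
    have "fenchel_conjugate d p \<le> ereal (p \<bullet> z - r z)"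
      by (rule upper) (use min in \<open>force simp: r_def\<close>)
    with lower[of p] show ?thesis by (metis antisym real_of_ereal.simps(1))
  qed
  show ?thesis
    unfolding gderiv_def has_derivative_at_alt
  proof (intro conjI allI impI)
    show "bounded_linear (\<lambda>h. h \<bullet> z)" by (rule bounded_linear_inner_left)
    fix \<epsilon> :: real assume "0 < \<epsilon>"
    with growth obtain c where c: "c > 0" and far: "\<And>x. x \<in> edom d \<Longrightarrow> norm (x - z) \<ge> \<epsilon> \<Longrightarrow>
        c * norm (x - z) \<le> (r x - p \<bullet> x) - (r z - p \<bullet> z)"
      unfolding r_def by meson
    show "\<exists>\<delta>>0. \<forall>q. norm (q - p) < \<delta> \<longrightarrow>
        norm (real_of_ereal (fenchel_conjugate d q) - real_of_ereal (fenchel_conjugate d p) - (q - p) \<bullet> z)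
          \<le> \<epsilon> * norm (q - p)"
    proof (intro exI[of _ c] conjI c allI impI)
      fix q assume q: "norm (q - p) < c"
      have "fenchel_conjugate d q \<le> ereal (q \<bullet> z - r z + \<epsilon> * norm (q - p))"
      proof (rule upper)
        fix x assume x: "x \<in> edom d"
        have cs: "(q - p) \<bullet> (x - z) \<le> norm (q - p) * norm (x - z)"
          by (rule norm_cauchy_schwarz)
        have "(q - p) \<bullet> (x - z) - ((r x - p \<bullet> x) - (r z - p \<bullet> z)) \<le> \<epsilon> * norm (q - p)"
        proof (cases "norm (x - z) \<ge> \<epsilon>")
          case True
          have "norm (q - p) * norm (x - z) \<le> c * norm (x - z)"
            using q by (intro mult_right_mono) auto
          moreover have "0 \<le> \<epsilon> * norm (q - p)" using \<open>0 < \<epsilon>\<close> by simp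
          ultimately show ?thesis using cs far[OF x True] by linarith
        next
          case False
          then have "norm (q - p) * norm (x - z) \<le> norm (q - p) * \<epsilon>"
            by (intro mult_left_mono) auto
          then show ?thesis using cs min[OF x] by (simp add: r_def mult.commute)
        qed
        then show "q \<bullet> x - r x \<le> q \<bullet> z - r z + \<epsilon> * norm (q - p)"
          by (simp add: inner_simps)
      qed
      with lower[of q]
      have "q \<bullet> z - r z \<le> real_of_ereal (fenchel_conjugate d q)"
        "real_of_ereal (fenchel_conjugate d q) \<le> q \<bullet> z - r z + \<epsilon> * norm (q - p)"
        by (cases "fenchel_conjugate d q"; simp)+
      then show "norm (real_of_ereal (fenchel_conjugate d q) - real_of_ereal (fenchel_conjugate d p)
          - (q - p) \<bullet> z) \<le> \<epsilon> * norm (q - p)"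
        by (simp add: at_p inner_simps)
    qed
  qed
qed

text \<open>The inverse relation between the two gradients, in subgradient form because the
  minimizer \<open>z\<close> is not yet known to be interior. Interiority of the iterates later
  upgrades the subgradient to a gradient.\<close>

lemma legendre_gradient_conjugate_subgradient:
  fixes d :: "'a::euclidean_space \<Rightarrow> ereal"
  assumes "legendre d" and "p \<in> interior (edom (fenchel_conjugate d))"
  shows "p \<in> subdifferential d (ext_gradient (fenchel_conjugate d) p)"
proof -
  have pr: "proper d" and cl: "closed (ext_epigraph d)" and cvx: "convex (ext_epigraph d)"
    using assms(1) by (auto simp: legendre_def)
  note iff = subdifferential_iff[OF pr]
  obtain K M where K: "K > 0"
    and coercive: "\<And>x. x \<in> edom d \<Longrightarrow> norm x \<le> K * (M + real_of_ereal (d x) - p \<bullet> x)"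
    using conjugate_interior_coercive[OF pr assms(2)] by blast
  obtain x1 where "x1 \<in> UNIV \<inter> edom d"
    using pr by (auto simp: proper_def edom_def)
  then obtain z where "z \<in> UNIV \<inter> edom d"
    and "\<And>x. x \<in> UNIV \<inter> edom d \<Longrightarrow> real_of_ereal (d z) - p \<bullet> z \<le> real_of_ereal (d x) - p \<bullet> x"
    using coercive_attains_min[OF pr cl K coercive closed_UNIV] by metis
  then have z: "z \<in> edom d"
    and min: "\<And>x. x \<in> edom d \<Longrightarrow> real_of_ereal (d z) - p \<bullet> z \<le> real_of_ereal (d x) - p \<bullet> x"
    by auto
  have pz: "p \<in> subdifferential d z"
    unfolding iff using z min by (force simp: inner_simps)
  have strict: "real_of_ereal (d z) - p \<bullet> z < real_of_ereal (d x) - p \<bullet> x"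
    if x: "x \<in> edom d" "x \<noteq> z" for x
  proof (rule ccontr)
    assume "\<not> ?thesis"
    then have "p \<in> subdifferential d x"
      unfolding iff using x(1) min by (force simp: inner_simps)
    with pz x(2) show False using legendre_subgradient_point_unique[OF assms(1)] by blast
  qed
  have "GDERIV (\<lambda>q. real_of_ereal (fenchel_conjugate d q)) p :> z"
  proof (rule GDERIV_conjugate_of_linear_growth[OF pr z min])
    fix \<epsilon> :: real assume "0 < \<epsilon>"
    from unique_min_linear_growth[OF pr cl cvx K coercive z strict this]
    show "\<exists>c>0. \<forall>x\<in>edom d. norm (x - z) \<ge> \<epsilon> \<longrightarrow>
        c * norm (x - z) \<le> (real_of_ereal (d x) - p \<bullet> x) - (real_of_ereal (d z) - p \<bullet> z)"
      by metis
  qed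
  then have "ext_gradient (fenchel_conjugate d) p = z"
    unfolding ext_gradient_def by (rule gradient_eqI)
  with pz show ?thesis by simp
qed

section \<open>The rate of Bregman gradient descent\<close>

text \<open>Bernoulli gives \<open>(1 + \<kappa>) ^ k - 1 \<ge> k * \<kappa>\<close>, so the
  geometric term always attains the minimum. For \<open>\<mu> = 0\<close> the sum is
  \<open>k\<close>, in agreement with the remaining term.\<close>

lemma eta_schedule_eq_sum:
  assumes "0 \<le> \<mu>" and "\<mu> < L"
  shows "eta_schedule L \<mu> k = (\<Sum>j<k. (1 + \<mu> / L) ^ j) / L"
proof (cases "k = 0 \<or> \<mu> = 0")
  case True
  then show ?thesis using assms by (auto simp: eta_schedule_def field_simps)
next
  case False
  define \<kappa> where "\<kappa> = \<mu> / L"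
  have \<kappa>: "\<kappa> > 0" using False assms by (simp add: \<kappa>_def)
  define s where "s = (\<Sum>j<k. (1 + \<kappa>) ^ j)"
  have geo: "(1 + \<kappa>) ^ k - 1 = \<kappa> * s"
    using power_diff_1_eq[of "1 + \<kappa>" k] by (simp add: s_def)
  have "1 + real k * \<kappa> \<le> (1 + \<kappa>) ^ k"
    using Bernoulli_inequality[of \<kappa> k] \<kappa> by simp
  then have "\<kappa> * real k \<le> \<kappa> * s" using geo by (simp add: algebra_simps)
  then have "real k \<le> s" using \<kappa> by simp
  moreover have "real k > 0" using False by simp
  ultimately have "min (1 / real k) (\<kappa> / (\<kappa> * s)) = 1 / s"
    using \<kappa> by (auto simp: min_def field_simps)
  then show ?thesis
    using False unfolding eta_schedule_def \<kappa>_def[symmetric] geo s_def[symmetric]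
    by (simp add: field_simps)
qed

text \<open>Step \<open>k\<close> is weighted by \<open>a ^ Suc k\<close> with
  \<open>a = 1 + \<mu> / L\<close>. The distances telescope since
  \<open>a * (L - \<mu>) = L - \<mu>\<^sup>2 / L\<close>, and monotonicity replaces all earlier
  values by the latest one.\<close>

lemma contractive_descent_rate:
  fixes \<phi> D :: "nat \<Rightarrow> real"
  assumes "0 \<le> \<mu>" and "\<mu> < L"
    and step: "\<And>k. \<phi> (Suc k) - c \<le> (L - \<mu>) * D k - L * D (Suc k)"
    and decreasing: "\<And>k. \<phi> (Suc k) \<le> \<phi> k"
    and nonneg: "\<And>k. 0 \<le> D k"
  shows "(\<Sum>j<k. (1 + \<mu> / L) ^ j) * (\<phi> k - c) \<le> L * D 0"
proof -
  define a where "a = 1 + \<mu> / L"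
  have a: "1 \<le> a" using assms by (simp add: a_def)
  have aL: "a * (L - \<mu>) \<le> L"
    using assms by (simp add: a_def field_simps)
  have telescope: "(\<Sum>j<k. a ^ Suc j) * (\<phi> k - c) + L * a ^ k * D k \<le> L * D 0" for k
  proof (induction k)
    case (Suc k)
    define s where "s = (\<Sum>j<k. a ^ Suc j)"
    have s: "0 \<le> s" unfolding s_def using a by (intro sum_nonneg) simp
    have "s * (\<phi> (Suc k) - c) \<le> s * (\<phi> k - c)"
      using s decreasing[of k] by (intro mult_left_mono) auto
    moreover have "a ^ Suc k * (\<phi> (Suc k) - c) \<le> a ^ Suc k * ((L - \<mu>) * D k - L * D (Suc k))"
      using a step[of k] by (intro mult_left_mono) auto
    moreover have "a * (L - \<mu>) * (a ^ k * D k) \<le> L * (a ^ k * D k)"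
      using aL a nonneg[of k] by (intro mult_right_mono) auto
    ultimately have "(s + a ^ Suc k) * (\<phi> (Suc k) - c) + L * a ^ Suc k * D (Suc k)
        \<le> s * (\<phi> k - c) + L * a ^ k * D k"
      by (simp add: algebra_simps)
    also have "\<dots> \<le> L * D 0" using Suc.IH by (simp add: s_def)
    finally show ?case by (simp add: s_def)
  qed simp
  show ?thesis
  \<comment> \<open>The telescoped weights carry one power of \<open>a\<close> more than the claim.
    Lowering them is legitimate only for a nonnegative gap; for a negative gap the left-hand side is
    at most 0 anyway.\<close>
  proof (cases "c \<le> \<phi> k")
    case True
    have "(\<Sum>j<k. a ^ j) * (\<phi> k - c) \<le> (\<Sum>j<k. a ^ Suc j) * (\<phi> k - c)"
      using True a by (intro mult_right_mono sum_mono power_increasing) auto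
    moreover have "0 \<le> L * a ^ k * D k"
      using assms a nonneg[of k] by simp
    ultimately show ?thesis using telescope[of k] by (simp add: a_def)
  next
    case False
    have "0 \<le> (\<Sum>j<k. a ^ j)" using a by (intro sum_nonneg) simp
    then have "(\<Sum>j<k. a ^ j) * (\<phi> k - c) \<le> 0"
      using False by (intro mult_nonneg_nonpos) auto
    moreover have "0 \<le> L * D 0" using assms nonneg[of 0] by simp
    ultimately show ?thesis by (simp add: a_def)
  qed
qed

section \<open>Bregman distances with extended real values\<close>

lemma bregman_eq_ereal:
  assumes "proper d" and "x \<in> edom d" and "y \<in> edom d"
  shows "bregman d x y =
    ereal (real_of_ereal (d x) - real_of_ereal (d y) - ext_gradient d y \<bullet> (x - y))"
  unfolding bregman_def
  by (subst proper_eq_ereal[OF assms(1,2)], subst proper_eq_ereal[OF assms(1,3)]) simp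

lemma bregman_eq_infinity:
  assumes "proper d" and "x \<notin> edom d" and "y \<in> edom d"
  shows "bregman d x y = \<infinity>"
  unfolding bregman_def
  by (subst proper_eq_ereal[OF assms(1,3)]) (use assms(2) in \<open>simp add: edom_def\<close>)

section \<open>From one descent step to the envelope bound\<close>

theorem proposition3:
  fixes d :: "'a::euclidean_space \<Rightarrow> ereal"
    and f :: "'a \<Rightarrow> real"
    and L \<mu> :: real
    and x0 :: 'a
    and x :: "nat \<Rightarrow> 'a"
  assumes legendre: "legendre d"
    and x0_interior: "x0 \<in> interior (edom d)"
    and f_convex: "convex_on (closure (edom d)) f"
    and f_differentiable: "\<forall>z\<in>interior (closure (edom d)). has_gradient_at f z"
    and \<mu>_L: "0 \<le> \<mu>" "\<mu> < L"
    and f_smooth: "relatively_smooth (L - \<mu>) d f"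
    and objective_minimizer:
      "\<exists>z\<in>interior (edom d). is_arg_min (objective d f \<mu> x0) (\<lambda>z. z \<in> closure (edom d)) z"
    and envelope_minimizer:
      "\<forall>\<eta>>0. \<exists>z\<in>interior (edom d).
         is_arg_min (envelope_objective d f \<mu> x0 \<eta>) (\<lambda>z. z \<in> closure (edom d)) z"
    and iterates: "x 0 = x0" "\<forall>k. x (Suc k) = bregman_gd_step d f L \<mu> x0 (x k)"
    and iterates_well_defined:
      "\<forall>k. x k \<in> interior (edom d) \<and>
           bregman_gd_dual_point d f L \<mu> x0 (x k) \<in> interior (edom (fenchel_conjugate d))"
  shows "implicit_envelope_descent d f \<mu> x0 (eta_schedule L \<mu>) x"
proof -
  have pr: "proper d" and cvx: "convex (ext_epigraph d)"
    and diff_d: "\<And>z. z \<in> interior (edom d) \<Longrightarrow> has_gradient_at (\<lambda>z. real_of_ereal (d z)) z"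
    using legendre by (auto simp: legendre_def)
  have L: "0 < L" using \<mu>_L by simp
  \<comment> \<open>Real-valued counterparts of the extended-valued notions, faithful on the domain
    of \<open>d\<close>; \<open>G\<phi>\<close> is the expected gradient of the objective.\<close>
  define r where "r z = real_of_ereal (d z)" for z
  define Gd where "Gd = ext_gradient d"
  define D where "D y z = r y - r z - Gd z \<bullet> (y - z)" for y z
  define \<phi> where "\<phi> y = f y + \<mu> * D y x0" for y
  define G\<phi> where "G\<phi> z = gradient f z + \<mu> *\<^sub>R (Gd z - Gd x0)" for z
  have int_edom: "z \<in> edom d" if "z \<in> interior (edom d)" for z
    using that interior_subset by blast
  have int_cl: "z \<in> interior (closure (edom d))" if "z \<in> interior (edom d)" for z
    using that interior_mono[OF closure_subset] by blast
  have convex_r: "convex_on (edom d) r"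
    unfolding r_def by (rule convex_on_edom[OF pr cvx])
  have grad_d: "GDERIV r z :> Gd z" if "z \<in> interior (edom d)" for z
    unfolding r_def Gd_def ext_gradient_def by (rule GDERIV_gradient[OF diff_d[OF that]])
  have grad_f: "GDERIV f z :> gradient f z" if "z \<in> interior (edom d)" for z
    using f_differentiable int_cl[OF that] by (blast intro: GDERIV_gradient)
  have bregman: "bregman d y z = ereal (D y z)" if "y \<in> edom d" "z \<in> edom d" for y z
    unfolding D_def r_def Gd_def by (rule bregman_eq_ereal[OF pr that])
  have D_nonneg: "0 \<le> D y z" if "y \<in> edom d" "z \<in> interior (edom d)" for y z
    using convex_on_above_gradient[OF convex_r int_edom[OF that(2)] that(1) grad_d[OF that(2)]]
    by (simp add: D_def)
  have objective: "objective d f \<mu> x0 y = ereal (\<phi> y)" if "y \<in> edom d" for y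
    unfolding objective_def \<phi>_def using bregman[OF that int_edom[OF x0_interior]] by simp
  have grad_objective: "ext_gradient (objective d f \<mu> x0) z = G\<phi> z"
    if z: "z \<in> interior (edom d)" for z
  proof -
    have "(f has_derivative (\<lambda>h. h \<bullet> gradient f z)) (at z)"
      "(r has_derivative (\<lambda>h. h \<bullet> Gd z)) (at z)"
      using grad_f[OF z] grad_d[OF z] by (auto simp: gderiv_def)
    then have "(\<phi> has_derivative (\<lambda>h. h \<bullet> G\<phi> z)) (at z)"
      unfolding \<phi>_def D_def G\<phi>_def
      by (auto intro!: derivative_eq_intros simp: fun_eq_iff inner_simps inner_commute algebra_simps)
    \<comment> \<open>The objective agrees with \<open>\<phi>\<close> on the open interior of the
      domain, which is all that a derivative at \<open>z\<close> sees.\<close>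
    then have "((\<lambda>z. real_of_ereal (objective d f \<mu> x0 z)) has_derivative (\<lambda>h. h \<bullet> G\<phi> z)) (at z)"
      by (rule has_derivative_transform_within_open[OF _ open_interior z])
        (simp add: objective int_edom)
    then show ?thesis
      unfolding ext_gradient_def by (intro gradient_eqI) (simp add: gderiv_def)
  qed
  have x_int: "x k \<in> interior (edom d)" for k
    using iterates_well_defined by blast
  have x_edom: "x k \<in> edom d" for k
    by (rule int_edom[OF x_int])
  \<comment> \<open>Applying the gradient of \<open>d\<close> to the update undoes the gradient of
    the conjugate, so the step becomes linear in the dual variables.\<close>
  have mirror_step: "G\<phi> (x k) = L *\<^sub>R (Gd (x k) - Gd (x (Suc k)))" for k
  proof -
    define p where "p = bregman_gd_dual_point d f L \<mu> x0 (x k)"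
    have p: "p = Gd (x k) - (1 / L) *\<^sub>R G\<phi> (x k)"
      unfolding p_def bregman_gd_dual_point_def grad_objective[OF x_int] Gd_def by simp
    have "p \<in> interior (edom (fenchel_conjugate d))"
      unfolding p_def using iterates_well_defined by blast
    from legendre_gradient_conjugate_subgradient[OF legendre this]
    have "p \<in> subdifferential d (x (Suc k))"
      using iterates(2) by (simp add: bregman_gd_step_def p_def)
    then have "p = Gd (x (Suc k))"
      unfolding subdifferential_iff[OF pr] r_def[symmetric]
      by (intro subgradient_eq_gradient[OF x_int grad_d[OF x_int]]) auto
    then have "Gd (x k) - Gd (x (Suc k)) = (1 / L) *\<^sub>R G\<phi> (x k)"
      using p by (simp add: algebra_simps)
    with L show ?thesis by simp
  qed
  have step: "\<phi> (x (Suc k)) - \<phi> y \<le> (L - \<mu>) * D y (x k) - L * D y (x (Suc k))"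
    if y: "y \<in> edom d" for y k
  proof -
    have "ereal (f (x (Suc k)) - f (x k) - gradient f (x k) \<bullet> (x (Suc k) - x k))
        \<le> ereal (L - \<mu>) * bregman d (x (Suc k)) (x k)"
      using f_smooth int_cl[OF x_int] unfolding relatively_smooth_def by blast
    then have upper: "f (x (Suc k)) - f (x k) - gradient f (x k) \<bullet> (x (Suc k) - x k)
        \<le> (L - \<mu>) * D (x (Suc k)) (x k)"
      by (simp add: bregman x_edom)
    have lower: "f (x k) + gradient f (x k) \<bullet> (y - x k) \<le> f y"
      using closure_subset x_edom y
      by (intro convex_on_above_gradient[OF f_convex _ _ grad_f[OF x_int]]) auto
    \<comment> \<open>Moving the base point of \<open>D\<close> changes it only by an affine
      function of the first argument. Hence \<open>\<phi>\<close> minus its linearization at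
      \<open>x k\<close> is the remainder of \<open>f\<close> plus
      \<open>\<mu> * D a (x k)\<close>.\<close>
    have D_x0: "D a x0 - D b x0 = D a b + (Gd b - Gd x0) \<bullet> (a - b)" for a b
      by (simp add: D_def inner_simps)
    have \<phi>_diff: "\<phi> a - \<phi> (x k) = f a - f (x k) - gradient f (x k) \<bullet> (a - x k)
        + \<mu> * D a (x k) + G\<phi> (x k) \<bullet> (a - x k)" for a
    proof -
      have "\<phi> a - \<phi> (x k) = f a - f (x k) + \<mu> * (D a x0 - D (x k) x0)"
        by (simp add: \<phi>_def algebra_simps)
      then show ?thesis
        unfolding D_x0 by (simp add: G\<phi>_def inner_simps algebra_simps)
    qed
    \<comment> \<open>The three-point identity. Its term \<open>- L * D (x (Suc k)) (x k)\<close>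
      absorbs the remainder at \<open>x (Suc k)\<close>, at most \<open>(L - \<mu>) + \<mu>\<close>
      times the same distance; the remainder at \<open>y\<close> is at least
      \<open>\<mu> * D y (x k)\<close> and yields the factor \<open>L - \<mu>\<close>.\<close>
    have "D y (x k) - D y (x (Suc k)) - D (x (Suc k)) (x k)
        = (Gd (x k) - Gd (x (Suc k))) \<bullet> (x (Suc k) - y)"
      by (simp add: D_def inner_simps)
    then have three_point: "G\<phi> (x k) \<bullet> (x (Suc k) - y)
        = L * (D y (x k) - D y (x (Suc k)) - D (x (Suc k)) (x k))"
      by (simp add: mirror_step)
    have "G\<phi> (x k) \<bullet> (x (Suc k) - x k) - G\<phi> (x k) \<bullet> (y - x k) = G\<phi> (x k) \<bullet> (x (Suc k) - y)"
      by (simp add: inner_simps)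
    with \<phi>_diff[of y] \<phi>_diff[of "x (Suc k)"] upper lower three_point
    show ?thesis by (simp add: algebra_simps)
  qed
  have decreasing: "\<phi> (x (Suc k)) \<le> \<phi> (x k)" for k
  proof -
    have "D (x k) (x k) = 0" by (simp add: D_def)
    moreover have "0 \<le> L * D (x k) (x (Suc k))"
      using L D_nonneg[OF x_edom x_int] by simp
    ultimately show ?thesis using step[OF x_edom, of k k] by simp
  qed
  define s where "s k = (\<Sum>j<k. (1 + \<mu> / L) ^ j)" for k
  have \<eta>: "eta_schedule L \<mu> k = s k / L" for k
    unfolding s_def by (rule eta_schedule_eq_sum[OF \<mu>_L])
  have s_mono: "s k \<le> s (Suc k)" for k
    using \<mu>_L by (simp add: s_def)
  have s_pos: "0 < s (Suc k)" for k
    unfolding s_def using \<mu>_L by (intro sum_pos) (auto simp: add_pos_nonneg)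
  have envelope: "objective d f \<mu> x0 (x (Suc k)) \<le> envelope_objective d f \<mu> x0 (s (Suc k) / L) y" for k y
  proof (cases "y \<in> edom d")
    case True
    have "s (Suc k) * (\<phi> (x (Suc k)) - \<phi> y) \<le> L * D y (x 0)"
      unfolding s_def using contractive_descent_rate[OF \<mu>_L, of "\<lambda>k. \<phi> (x k)" "\<phi> y" "\<lambda>k. D y (x k)"]
      using step[OF True] decreasing D_nonneg[OF True x_int] by blast
    \<comment> \<open>Division by \<open>s (Suc k)\<close> turns \<open>L\<close> into the
      reciprocal of the schedule value.\<close>
    then have "\<phi> (x (Suc k)) \<le> \<phi> y + 1 / (s (Suc k) / L) * D y x0"
      using s_pos[of k] by (simp add: iterates(1) field_simps)
    then show ?thesis
      unfolding envelope_objective_def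
      by (simp add: objective[OF True] objective[OF x_edom] bregman[OF True int_edom[OF x0_interior]])
  next
    case False
    have "bregman d y x0 = \<infinity>"
      by (rule bregman_eq_infinity[OF pr False int_edom[OF x0_interior]])
    \<comment> \<open>For \<open>\<mu> = 0\<close> the objective stays finite here since
      \<open>0 * \<infinity> = 0\<close>; the positive factor \<open>1 / \<eta>\<close> of the added
      term makes the value infinite all the same.\<close>
    then have "envelope_objective d f \<mu> x0 (s (Suc k) / L) y = \<infinity>"
      unfolding envelope_objective_def objective_def using \<mu>_L(1) L s_pos[of k] by simp
    then show ?thesis by simp
  qed
  show ?thesis
    unfolding implicit_envelope_descent_def envelope_min_def \<eta>
    using L s_pos s_mono envelope
    by (auto simp: s_def[of 0] intro!: INF_greatest divide_right_mono)
qed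

end
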